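(* Let $d\ge 1$, $1\le m\le d$, $y\in\{+1,-1\}$, let $e_1,\dots,e_d$ be the principal components (an orthonormal basis of $\mathbb{R}^d$), let $z=\sum_{i=1}^d\alpha_i e_i\in\mathbb{R}^d$ be a representation with label $y$, and let $\Delta q=\sum_{i=1}^d\gamma_i e_i\in\mathbb{R}^d$ be the learned decision boundary vector. Suppose $z$ is misclassified by $\Delta q$, i.e. $y\,(z\cdot\Delta q)<0$. If both of the following conditions hold: $$y\sum_{i=1}^m\alpha_i\gamma_i<0\quad\text{and}\quad y\sum_{i=m+1}^d\alpha_i\gamma_i>0,$$ $$\left|\sum_{i=1}^m\alpha_i\gamma_i\right|>\left|\sum_{i=m+1}^d\alpha_i\gamma_i\right|,$$ then the misclassification is corrected by removing the top-$m$ principal components, i.e. $y\,(\hat z\cdot\Delta\hat q)>0$, where $\hat z$ and $\Delta\hat q$ are the trimmed representation and the trimmed decision boundary vector.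
   Context: Setting: binary classification with labels in $\{+1,-1\}$ and representations in $\mathbb{R}^d$, with no bias term. The classifier has learned prototypes $q_{+1},q_{-1}\in\mathbb{R}^d$; the learned decision boundary vector is $\Delta q=q_{+1}-q_{-1}$. A representation $z$ with label $y$ is classified correctly by a decision boundary vector $v$ if $y\,(z\cdot v)>0$ and misclassified if $y\,(z\cdot v)<0$. Principal components: given $z$ and representations $\tilde z_1,\dots,\tilde z_n\in\mathbb{R}^d$ of augmented variants of the same sample, let $\mathbf{Z}$ be the matrix with rows $z,\tilde z_1,\dots,\tilde z_n$ and $\bar{\mathbf{Z}}$ the matrix of the same size all of whose rows are the mean of these $n+1$ vectors. Then $e_1,\dots,e_d$ are orthonormal eigenvectors of $(\mathbf{Z}-\bar{\mathbf{Z}})^\top(\mathbf{Z}-\bar{\mathbf{Z}})$, ordered by non-increasing eigenvalue; they form an orthonormal basis of $\mathbb{R}^d$. Write $\alpha_i=z\cdot e_i$ and $\gamma_i=\Delta q\cdot e_i$. Trimming (removing the top-$m$ principal components): $\hat z=z-\sum_{i=1}^m(z\cdot e_i)e_i$, $\hat q_{\pm1}=q_{\pm1}-\sum_{i=1}^m(q_{\pm1}\cdot e_i)e_i$, and $\Delta\hat q=\hat q_{+1}-\hat q_{-1}$. The updated prediction is correct iff $y\,(\hat z\cdot\Delta\hat q)>0$. *)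

theory Defs
  imports "HOL-Analysis.Analysis"
begin

definition correctly_classified :: "real \<Rightarrow> real ^ 'd \<Rightarrow> real ^ 'd \<Rightarrow> bool" where
  "correctly_classified y z v \<longleftrightarrow> y * (z \<bullet> v) > 0"

definition misclassified :: "real \<Rightarrow> real ^ 'd \<Rightarrow> real ^ 'd \<Rightarrow> bool" where
  "misclassified y z v \<longleftrightarrow> y * (z \<bullet> v) < 0"

text \<open>
  The rows of a data matrix are indexed by a finite type; with \<open>n\<close> augmented variants of a
  sample, that type has \<open>n + 1\<close> elements.
\<close>

definition mean_matrix :: "real ^ 'd ^ 'r \<Rightarrow> real ^ 'd ^ 'r" where
  "mean_matrix Z = (\<chi> r. (1 / real CARD('r)) *\<^sub>R (\<Sum>k\<in>UNIV. row k Z))"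

definition scatter_matrix :: "real ^ 'd ^ 'r \<Rightarrow> real ^ 'd ^ 'd" where
  "scatter_matrix Z = transpose (Z - mean_matrix Z) ** (Z - mean_matrix Z)"

text \<open>
  Only the values \<open>e 1, \<dots>, e d\<close> with \<open>d = CARD('d)\<close> matter. Principal components are not unique
  (signs, repeated eigenvalues), so this is a predicate; orthonormality makes each \<open>e i\<close> nonzero,
  hence a genuine eigenvector.
\<close>

definition principal_components :: "real ^ 'd ^ 'r \<Rightarrow> (nat \<Rightarrow> real ^ 'd) \<Rightarrow> bool" where
  "principal_components Z e \<longleftrightarrow>
     (\<forall>i\<in>{1..CARD('d)}. \<forall>j\<in>{1..CARD('d)}. e i \<bullet> e j = (if i = j then 1 else 0)) \<and>
     (\<exists>ev :: nat \<Rightarrow> real.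
        (\<forall>i\<in>{1..CARD('d)}. scatter_matrix Z *v e i = ev i *\<^sub>R e i) \<and>
        (\<forall>i\<in>{1..CARD('d)}. \<forall>j\<in>{1..CARD('d)}. i \<le> j \<longrightarrow> ev j \<le> ev i))"

definition trim :: "nat \<Rightarrow> (nat \<Rightarrow> real ^ 'd) \<Rightarrow> real ^ 'd \<Rightarrow> real ^ 'd" where
  "trim m e v = v - (\<Sum>i=1..m. (v \<bullet> e i) *\<^sub>R e i)"

end

theory Submission
  imports Defs
begin

text \<open>Trimming is the orthogonal projection onto the span of e_(m+1), ..., e_d. By linearity
  (\<open>trim_diff\<close>) the difference of the trimmed prototypes is the trimmed \<Delta>q, and
  by orthonormality (\<open>inner_trim_trim\<close>) the trimmed score is exactly the tail of the
  sum of \<alpha>_i \<gamma>_i over i > m. The harmful first m terms are gone, and the tail has the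
  sign of y by hypothesis.\<close>

lemma orthonormal_family_expand:
  fixes e :: "nat \<Rightarrow> 'a::euclidean_space"
  assumes orth: "\<And>i j. i \<in> I \<Longrightarrow> j \<in> I \<Longrightarrow> e i \<bullet> e j = (if i = j then 1 else 0)"
    and card: "card I = DIM('a)"
  shows "(\<Sum>i\<in>I. (v \<bullet> e i) *\<^sub>R e i) = v"
proof -
  have fin: "finite I"
    using card by (intro card_ge_0_finite) simp
  have inj: "inj_on e I"
    using orth by (metis inj_onI zero_neq_one)
  have "pairwise orthogonal (e ` I)"
    using orth by (auto simp: pairwise_def orthogonal_def)
  moreover have "0 \<notin> e ` I"
    using orth by (metis imageE inner_zero_left zero_neq_one)
  ultimately have "independent (e ` I)"
    by (rule pairwise_orthogonal_independent)
  \<comment> \<open>Injectivity keeps the image at full size, so it is an independent set of as many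
    vectors as the dimension.\<close>
  then have "UNIV \<subseteq> span (e ` I)"
    using card card_image[OF inj] by (intro card_ge_dim_independent) auto
  then have "v - (\<Sum>i\<in>I. (v \<bullet> e i) *\<^sub>R e i) \<in> span (e ` I)"
    by blast
  moreover have "orthogonal (v - (\<Sum>i\<in>I. (v \<bullet> e i) *\<^sub>R e i)) x" if x: "x \<in> e ` I" for x
  proof -
    obtain j where j: "j \<in> I" "x = e j" using x by blast
    have "(\<Sum>i\<in>I. (v \<bullet> e i) * (e i \<bullet> e j)) = (\<Sum>i\<in>I. if i = j then v \<bullet> e i else 0)"
      using j orth by (intro sum.cong) auto
    then show ?thesis
      using j fin by (simp add: orthogonal_def inner_diff_left inner_sum_left)
  qed
  \<comment> \<open>The residual lies in the span and is orthogonal to every generator, hence to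
    itself, so it vanishes.\<close>
  ultimately have "orthogonal (v - (\<Sum>i\<in>I. (v \<bullet> e i) *\<^sub>R e i)) (v - (\<Sum>i\<in>I. (v \<bullet> e i) *\<^sub>R e i))"
    by (rule orthogonal_to_span)
  then show ?thesis
    by (simp add: orthogonal_self)
qed

lemma trim_diff: "trim m e u - trim m e v = trim m e (u - v)"
  by (simp add: trim_def inner_diff_left scaleR_left_diff_distrib sum_subtractf)

text \<open>Since the family is a full orthonormal basis, subtracting the first m terms of the
  expansion of a vector leaves its tail; the inner product of two tails then collapses to the
  diagonal terms.\<close>

lemma inner_trim_trim:
  assumes orth: "\<And>i j. i \<in> {1..CARD('d)} \<Longrightarrow> j \<in> {1..CARD('d)} \<Longrightarrow>
      e i \<bullet> e j = (if i = j then 1 else 0)"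
    and "m \<le> CARD('d)"
  shows "trim m e u \<bullet> trim m e (v :: real ^ 'd)
    = (\<Sum>i=m+1..CARD('d). (u \<bullet> e i) * (v \<bullet> e i))"
proof -
  have tail: "trim m e w = (\<Sum>i=m+1..CARD('d). (w \<bullet> e i) *\<^sub>R e i)" for w :: "real ^ 'd"
  proof -
    have "{1..CARD('d)} = {1..m} \<union> {m+1..CARD('d)}"
      using \<open>m \<le> CARD('d)\<close> by auto
    then have "(\<Sum>i=1..CARD('d). (w \<bullet> e i) *\<^sub>R e i)
        = (\<Sum>i=1..m. (w \<bullet> e i) *\<^sub>R e i) + (\<Sum>i=m+1..CARD('d). (w \<bullet> e i) *\<^sub>R e i)"
      by (simp add: sum.union_disjoint)
    moreover have "(\<Sum>i=1..CARD('d). (w \<bullet> e i) *\<^sub>R e i) = w"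
      using orth by (intro orthonormal_family_expand) auto
    ultimately show ?thesis
      by (simp add: trim_def algebra_simps)
  qed
  \<comment> \<open>Coordinates beyond m survive trimming, so only the left factor has to be
    expanded below.\<close>
  have "e i \<bullet> trim m e v = v \<bullet> e i" if "i \<in> {m+1..CARD('d)}" for i
  proof -
    have "(\<Sum>j=m+1..CARD('d). (v \<bullet> e j) * (e i \<bullet> e j))
        = (\<Sum>j=m+1..CARD('d). if j = i then v \<bullet> e j else 0)"
      using that orth by (intro sum.cong) auto
    then show ?thesis
      using that by (simp add: tail inner_sum_right)
  qed
  then show ?thesis
    by (simp add: tail[of u] inner_sum_left)
qed

theorem proposition1:
  fixes Z :: "real ^ 'd ^ 'r" and r0 :: 'r
    and z q_pos q_neg \<Delta>q :: "real ^ 'd"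
    and e :: "nat \<Rightarrow> real ^ 'd"
    and \<alpha> \<gamma> :: "nat \<Rightarrow> real"
    and y :: real and m :: nat
  assumes "1 \<le> m" and "m \<le> CARD('d)"
    and "y \<in> {1, -1}"
    and "row r0 Z = z"
    and "principal_components Z e"
    and "\<Delta>q = q_pos - q_neg"
    and "\<And>i. i \<in> {1..CARD('d)} \<Longrightarrow> \<alpha> i = z \<bullet> e i"
    and "\<And>i. i \<in> {1..CARD('d)} \<Longrightarrow> \<gamma> i = \<Delta>q \<bullet> e i"
    and "misclassified y z \<Delta>q"
    and "y * (\<Sum>i=1..m. \<alpha> i * \<gamma> i) < 0"
    and "y * (\<Sum>i=m+1..CARD('d). \<alpha> i * \<gamma> i) > 0"
    and "\<bar>\<Sum>i=1..m. \<alpha> i * \<gamma> i\<bar> > \<bar>\<Sum>i=m+1..CARD('d). \<alpha> i * \<gamma> i\<bar>"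
  shows "correctly_classified y (trim m e z) (trim m e q_pos - trim m e q_neg)"
proof -
  have "trim m e z \<bullet> trim m e \<Delta>q = (\<Sum>i=m+1..CARD('d). (z \<bullet> e i) * (\<Delta>q \<bullet> e i))"
    using assms(2,5) by (intro inner_trim_trim) (auto simp: principal_components_def)
  also have "\<dots> = (\<Sum>i=m+1..CARD('d). \<alpha> i * \<gamma> i)"
    using assms(7,8) by (intro sum.cong) auto
  \<comment> \<open>\<open>trim_diff\<close> folds the two trimmed prototypes into
    \<open>trim m e \<Delta>q\<close>; the sign condition on the tail is then the claim.\<close>
  finally show ?thesis
    using assms(6,11) by (simp add: correctly_classified_def trim_diff)
qed

end
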